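(* Let $\mathcal{A}$ be a spanning toric hyperplane arrangement in general position on $\mathbb{T}^n$, consisting of simple hyperplanes and with $|\mathcal{A}|\ge n$. Then for every $k\in\{0,1,\dots,n\}$ there is a bijection between the set $\Sigma_k(\mathcal{A})$ of $k$-flats and the set $\Sigma_{n-k}(\mathcal{A})$ of $(n-k)$-flats of $\mathcal{A}$. In particular, $f_k(\mathcal{A})=f_{n-k}(\mathcal{A})$, i.e. the $f$-vector $(f_0(\mathcal{A}),\dots,f_n(\mathcal{A}))$ is symmetric.
   Context: $\mathbb{T}^n=\mathbb{R}^n/\mathbb{Z}^n$ and $S^1=\mathbb{R}/\mathbb{Z}$. An (affine toric) hyperplane on $\mathbb{T}^n$ is a set $H=\{x\in\mathbb{T}^n : a_1x_1+\dots+a_nx_n=b\}$, where $\mathbf{a}=\langle a_1,\dots,a_n\rangle\in\mathbb{Z}^n\setminus\{0\}$ is its normal vector and $b\in S^1$ is its intercept. $H$ is simple if $\gcd(a_1,\dots,a_n)=1$. A toric hyperplane arrangement $\mathcal{A}$ on $\mathbb{T}^n$ is a finite set of hyperplanes; $|\mathcal{A}|$ is its number of hyperplanes. General position: for all distinct $H_1,\dots,H_m\in\mathcal{A}$, if $m\le n$ then $\dim(H_1\cap\dots\cap H_m)\le n-m$ (satisfied when the intersection is empty), and if $m>n$ then $H_1\cap\dots\cap H_m=\emptyset$. Spanning (for $|\mathcal{A}|\ge n$): there is a subset of $n$ hyperplanes of $\mathcal{A}$ with non-empty intersection (for general position arrangements: $n$ hyperplanes whose normal vectors span $\mathbb{R}^n$).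 Flats: write $\mathcal{A}=\{H_i\}_{i\in I}$. The set of $0$-flats is $\Sigma_0(\mathcal{A})=\bigcup_{S\subseteq I,|S|=n}\pi_0(\bigcap_{i\in S}H_i)$. For $0<k<n$, inductively, $\Sigma_k(\mathcal{A})=\bigcup_{S\subseteq I,|S|=n-k}\pi_0\big(\bigcap_{i\in S}H_i\setminus\bigcup_{j<k}\bigcup_{\sigma\in\Sigma_j(\mathcal{A})}\sigma\big)$. Finally $\Sigma_n(\mathcal{A})=\pi_0(\mathbb{T}^n\setminus\bigcup_{i\in I}H_i)$. Here $\pi_0$ is the set of connected components. $f_k(\mathcal{A})=|\Sigma_k(\mathcal{A})|$. *)

theory Defs
  imports "HOL-Analysis.Analysis"
begin

definition congruent_Z :: "real \<Rightarrow> real \<Rightarrow> bool"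
  where "congruent_Z x y \<longleftrightarrow> x - y \<in> \<int>"

lemma equivp_congruent_Z: "equivp congruent_Z"
proof (rule equivpI)
  show "reflp congruent_Z"
    by (auto simp: reflp_def congruent_Z_def)
  show "symp congruent_Z"
    unfolding symp_def congruent_Z_def by (metis Ints_minus minus_diff_eq)
  show "transp congruent_Z"
  proof (rule transpI)
    fix x y z :: real
    assume "congruent_Z x y" "congruent_Z y z"
    then have "(x - y) + (y - z) \<in> \<int>"
      unfolding congruent_Z_def by (rule Ints_add)
    then show "congruent_Z x z"
      by (simp add: congruent_Z_def)
  qed
qed

quotient_type circle = real / congruent_Z
  morphisms rep_circle to_circle
  by (rule equivp_congruent_Z)

definition congruent_Zn :: "real ^ 'n \<Rightarrow> real ^ 'n \<Rightarrow> bool"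
  where "congruent_Zn x y \<longleftrightarrow> (\<forall>i. x $ i - y $ i \<in> \<int>)"

lemma equivp_congruent_Zn: "equivp (congruent_Zn :: real ^ 'n \<Rightarrow> _)"
proof (rule equivpI)
  show "reflp congruent_Zn"
    by (auto simp: reflp_def congruent_Zn_def)
  show "symp congruent_Zn"
    unfolding symp_def congruent_Zn_def by (metis Ints_minus minus_diff_eq)
  show "transp (congruent_Zn :: real ^ 'n \<Rightarrow> _)"
  proof (rule transpI)
    fix x y z :: "real ^ 'n"
    assume "congruent_Zn x y" "congruent_Zn y z"
    then have "(x $ i - y $ i) + (y $ i - z $ i) \<in> \<int>" for i
      unfolding congruent_Zn_def by (intro Ints_add) auto
    then show "congruent_Zn x z"
      by (simp add: congruent_Zn_def)
  qed
qed

quotient_type 'n torus = "real ^ 'n" / congruent_Zn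
  morphisms rep_torus to_torus
  by (rule equivp_congruent_Zn)

text \<open>The topology of the torus is the quotient topology.\<close>

instantiation torus :: (finite) topological_space
begin

definition open_torus :: "'a torus set \<Rightarrow> bool"
  where "open_torus U \<longleftrightarrow> open (to_torus -` U)"

instance
proof
  show "open (UNIV :: 'a torus set)"
    by (simp add: open_torus_def)
  show "open (S \<inter> T)" if "open S" "open T" for S T :: "'a torus set"
    using that by (simp add: open_torus_def open_Int)
  show "open (\<Union>K)" if "\<forall>S\<in>K. open S" for K :: "'a torus set set"
    using that by (auto simp add: open_torus_def vimage_Union)
qed

end

text \<open>For integral \<open>a\<close>, the class of \<open>a\<^sub>1 x\<^sub>1 + \<dots> + a\<^sub>n x\<^sub>n\<close> in \<open>\<real>/\<int>\<close> depends only on the class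
  of \<open>x\<close> in \<open>\<real>\<^sup>n/\<int>\<^sup>n\<close>, so it does not matter which representative \<open>x\<close> of a point is used.\<close>

definition toric_hyperplane :: "int ^ ('n::finite) \<Rightarrow> circle \<Rightarrow> 'n torus set"
  where "toric_hyperplane a b =
    {to_torus x | x. to_circle (\<Sum>i\<in>UNIV. real_of_int (a $ i) * x $ i) = b}"

lemma to_circle_sum_cong:
  assumes "to_torus x = to_torus y"
  shows "to_circle (\<Sum>i\<in>UNIV. real_of_int (a $ i) * x $ i) =
         to_circle (\<Sum>i\<in>UNIV. real_of_int (a $ i) * y $ i)"
proof -
  have "x $ i - y $ i \<in> \<int>" for i
    using assms unfolding torus.abs_eq_iff congruent_Zn_def by blast
  then have "(\<Sum>i\<in>UNIV. real_of_int (a $ i) * (x $ i - y $ i)) \<in> \<int>"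
    by (intro Ints_sum Ints_mult Ints_of_int)
  then show ?thesis
    unfolding circle.abs_eq_iff congruent_Z_def right_diff_distrib sum_subtractf .
qed

lemma to_torus_in_toric_hyperplane_iff:
  "to_torus x \<in> toric_hyperplane a b \<longleftrightarrow> to_circle (\<Sum>i\<in>UNIV. real_of_int (a $ i) * x $ i) = b"
proof
  assume "to_torus x \<in> toric_hyperplane a b"
  then obtain y where y: "to_torus x = to_torus y"
      "to_circle (\<Sum>i\<in>UNIV. real_of_int (a $ i) * y $ i) = b"
    unfolding toric_hyperplane_def by blast
  show "to_circle (\<Sum>i\<in>UNIV. real_of_int (a $ i) * x $ i) = b"
    using to_circle_sum_cong[OF y(1)] y(2) by (rule trans)
next
  assume "to_circle (\<Sum>i\<in>UNIV. real_of_int (a $ i) * x $ i) = b"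
  then show "to_torus x \<in> toric_hyperplane a b"
    unfolding toric_hyperplane_def by blast
qed

definition is_hyperplane :: "'n::finite torus set \<Rightarrow> bool"
  where "is_hyperplane H \<longleftrightarrow> (\<exists>a b. a \<noteq> 0 \<and> H = toric_hyperplane a b)"

definition simple_hyperplane :: "'n::finite torus set \<Rightarrow> bool"
  where "simple_hyperplane H \<longleftrightarrow>
    (\<exists>a b. a \<noteq> 0 \<and> H = toric_hyperplane a b \<and> Gcd (range (\<lambda>i. a $ i)) = 1)"

definition toric_arrangement :: "'n::finite torus set set \<Rightarrow> bool"
  where "toric_arrangement A \<longleftrightarrow> finite A \<and> (\<forall>H\<in>A. is_hyperplane H)"

text \<open>An intersection of toric hyperplanes is a finite disjoint union of translates of subtori,
  each of which is the image of an affine subspace of \<open>\<real>\<^sup>n\<close> of the same dimension. The dimension is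
  therefore the largest dimension of an affine subspace of \<open>\<real>\<^sup>n\<close> projecting into the set. The
  admissible dimensions lie between \<open>-1\<close> and \<open>n\<close>, and the empty set has dimension \<open>-1\<close>.\<close>

definition toric_dim :: "'n::finite torus set \<Rightarrow> int"
  where "toric_dim X = Max {aff_dim L | L :: (real ^ 'n) set. affine L \<and> to_torus ` L \<subseteq> X}"

lemma finite_toric_dim_candidates:
  "finite {aff_dim L | L :: (real ^ 'n::finite) set. affine L \<and> to_torus ` L \<subseteq> X}"
proof (rule finite_subset)
  show "{aff_dim L | L :: (real ^ 'n) set. affine L \<and> to_torus ` L \<subseteq> X} \<subseteq> {-1..int CARD('n)}"
  proof
    fix d
    assume "d \<in> {aff_dim L | L :: (real ^ 'n) set. affine L \<and> to_torus ` L \<subseteq> X}"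
    then obtain L :: "(real ^ 'n) set" where "d = aff_dim L"
      by blast
    then show "d \<in> {-1..int CARD('n)}"
      using aff_dim_geq[of L] aff_dim_le_DIM[of L] by simp
  qed
qed simp

definition general_position :: "'n::finite torus set set \<Rightarrow> bool"
  where "general_position A \<longleftrightarrow>
    (\<forall>S\<subseteq>A. (card S \<le> CARD('n) \<longrightarrow> toric_dim (\<Inter>S) \<le> int (CARD('n)) - int (card S)) \<and>
            (card S > CARD('n) \<longrightarrow> \<Inter>S = {}))"

definition spanning :: "'n::finite torus set set \<Rightarrow> bool"
  where "spanning A \<longleftrightarrow> (\<exists>S\<subseteq>A. card S = CARD('n) \<and> \<Inter>S \<noteq> {})"

text \<open>There are no flats of dimension greater than \<open>n\<close>. Members of \<^const>\<open>components\<close> are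
  non-empty.\<close>

function flats :: "'n::finite torus set set \<Rightarrow> nat \<Rightarrow> 'n torus set set"
  where "flats A k =
    (if k = 0 then \<Union>S\<in>{S. S \<subseteq> A \<and> card S = CARD('n)}. components (\<Inter>S)
     else if k < CARD('n) then
       \<Union>S\<in>{S. S \<subseteq> A \<and> card S = CARD('n) - k}. components (\<Inter>S - (\<Union>j\<in>{..<k}. \<Union>(flats A j)))
     else if k = CARD('n) then components (UNIV - \<Union>A)
     else {})"
  by pat_completeness auto
termination by lexicographic_order

declare flats.simps [simp del]

definition f_number :: "'n::finite torus set set \<Rightarrow> nat \<Rightarrow> nat"
  where "f_number A k = card (flats A k)"

end

theory Submission imports Defs begin

text \<open>The proof is a sweep. Lift the arrangement to \<open>\<real>\<^sup>n\<close>, where each hyperplane becomes the family of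
parallel hyperplanes on which an affine function (its level) takes an integer value, and choose a
linear functional, the height, that is not constant along any intersection line of the lifted
arrangement. The closure of every cell is a polytope, bounded because the arrangement is spanning,
so the height attains its minimum on it at a single vertex, the bottom of the cell. General
position puts exactly \<open>n\<close> lifted hyperplanes through a vertex \<open>v\<close>, with independent normals.
Locally the arrangement therefore looks like the coordinate hyperplanes, and for every subset \<open>T\<close> of
the \<open>n\<close> hyperplanes through \<open>v\<close> there is exactly one cell with bottom \<open>v\<close> that lies on the
hyperplanes in \<open>T\<close> and on no others: along each of the remaining \<open>n - |T|\<close> edges at \<open>v\<close> it must leave \<open>v\<close> in
the direction in which the height increases.

All of this is invariant under integer translations. Since the \<open>k\<close>-flats on the torus are the images
of the cells that lie on exactly \<open>n - k\<close> hyperplanes (\<open>flats_eq_cells\<close>), they correspond to the pairs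
\<open>(p, T)\<close> of a vertex \<open>p\<close> and an \<open>(n - k)\<close>-element set \<open>T\<close> of hyperplanes through \<open>p\<close>
(\<open>bij_betw_flat_above\<close>). Replacing \<open>T\<close> by its complement among the \<open>n\<close> hyperplanes through \<open>p\<close>
exchanges the pairs for \<open>k\<close> with those for \<open>n - k\<close>, and this is the required bijection.\<close>

section \<open>Generic linear functionals\<close>

text \<open>Fewer than \<open>DIM('e)\<close> vectors span a null set, and finitely many null sets do not cover the space.\<close>

lemma generic_functional_exists:
  fixes u :: "'h \<Rightarrow> 'e::euclidean_space"
  assumes "finite A"
  shows "\<exists>height. \<forall>S\<subseteq>A. card S < DIM('e) \<longrightarrow> height \<notin> span (u ` S)"
proof -
  have "negligible (span (u ` S))" if "S \<subseteq> A" "card S < DIM('e)" for S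
  proof (rule negligible_lowdim)
    have "finite S"
      using that assms finite_subset by blast
    then have "dim (u ` S) \<le> card S"
      by (meson card_image_le dim_le_card' finite_imageI order_trans)
    then show "dim (span (u ` S)) < DIM('e)"
      using that by (simp add: dim_span)
  qed
  then have "negligible (\<Union>S\<in>{S. S \<subseteq> A \<and> card S < DIM('e)}. span (u ` S))"
    using assms by (intro negligible_Union) auto
  then have "(\<Union>S\<in>{S. S \<subseteq> A \<and> card S < DIM('e)}. span (u ` S)) \<noteq> UNIV"
    using non_negligible_UNIV by metis
  then show ?thesis
    by blast
qed

lemma exists_orthogonal_nonzero_inner:
  fixes height :: "'e::euclidean_space"
  assumes "height \<notin> span B"
  shows "\<exists>d. (\<forall>b\<in>B. b \<bullet> d = 0) \<and> height \<bullet> d \<noteq> 0"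
proof -
  obtain y z where yz: "y \<in> span B" "\<And>w. w \<in> span B \<Longrightarrow> orthogonal z w" "height = y + z"
    using orthogonal_subspace_decomp_exists[of B height] by metis
  have "z \<noteq> 0"
    using yz assms by auto
  moreover have "height \<bullet> z = z \<bullet> z"
    using yz(2)[OF yz(1)] yz(3) by (simp add: orthogonal_def inner_left_distrib inner_commute[of y])
  moreover have "\<forall>b\<in>B. b \<bullet> z = 0"
    using yz(2) span_base by (metis orthogonal_def inner_commute)
  ultimately show ?thesis
    by (intro exI[of _ z]) auto
qed

section \<open>Cells of a lifted arrangement and their bottoms\<close>

text \<open>The lift of a toric arrangement to the covering space: the hyperplane \<open>H\<close> becomes the family of
parallel hyperplanes \<open>level H x \<in> \<int>\<close>. The assumptions on \<open>walls\<close> are what general position and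
spanning amount to upstairs, and the last one is the genericity of the height functional.\<close>

locale generic_arrangement =
  fixes A :: "'h set" and normal :: "'h \<Rightarrow> 'e::euclidean_space" and offset :: "'h \<Rightarrow> real"
    and height :: 'e
  fixes level :: "'h \<Rightarrow> 'e \<Rightarrow> real" and walls :: "'e \<Rightarrow> 'h set"
  defines "level H x \<equiv> normal H \<bullet> x - offset H"
    and "walls x \<equiv> {H\<in>A. level H x \<in> \<int>}"
  assumes finite_A: "finite A"
    and card_walls_le: "card (walls x) \<le> DIM('e)"
    and vertex_normals:
      "card (walls v) = DIM('e) \<Longrightarrow> (\<And>H. H \<in> walls v \<Longrightarrow> normal H \<bullet> d = 0) \<Longrightarrow> d = 0"
    and vertex_exists: "\<exists>v. card (walls v) = DIM('e)"
    and generic: "S \<subseteq> A \<Longrightarrow> card S < DIM('e) \<Longrightarrow> height \<notin> span (normal ` S)"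
begin

text \<open>Floor and ceiling together record the open unit interval that contains a level, or its exact value
if that is an integer. A cell is thus a relatively open face of the lifted arrangement, of any
dimension, and the closed cell is its closure.\<close>

definition cell :: "'e \<Rightarrow> 'e set"
  where "cell x = {y. \<forall>H\<in>A. \<lfloor>level H y\<rfloor> = \<lfloor>level H x\<rfloor> \<and> \<lceil>level H y\<rceil> = \<lceil>level H x\<rceil>}"

definition closed_cell :: "'e \<Rightarrow> 'e set"
  where "closed_cell x =
    {y. \<forall>H\<in>A. real_of_int \<lfloor>level H x\<rfloor> \<le> level H y \<and> level H y \<le> real_of_int \<lceil>level H x\<rceil>}"

definition bottom :: "'e \<Rightarrow> 'e \<Rightarrow> bool"
  where "bottom x v \<longleftrightarrow> v \<in> closed_cell x \<and> (\<forall>y\<in>closed_cell x. height \<bullet> v \<le> height \<bullet> y)"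

lemma walls_subset: "walls x \<subseteq> A"
  by (auto simp: walls_def)

lemma finite_walls: "finite (walls x)"
  using walls_subset finite_A by (rule finite_subset)

lemma level_add: "level H (x + d) = level H x + normal H \<bullet> d"
  by (simp add: level_def inner_right_distrib)

lemma self_in_cell: "x \<in> cell x"
  by (simp add: cell_def)

lemma self_in_closed_cell: "x \<in> closed_cell x"
  by (simp add: closed_cell_def)

lemma cell_eq_if_mem: "y \<in> cell x \<Longrightarrow> cell y = cell x"
  by (simp add: cell_def)

lemma in_Ints_iff_floor_eq_ceiling: "(r::real) \<in> \<int> \<longleftrightarrow> \<lfloor>r\<rfloor> = \<lceil>r\<rceil>"
  by (metis Ints_cases Ints_of_int ceiling_of_int floor_of_int le_of_int_ceiling of_int_floor_le order_antisym)

lemma ceiling_eq_floor_if: "\<lceil>r::real\<rceil> = (if r \<in> \<int> then \<lfloor>r\<rfloor> else \<lfloor>r\<rfloor> + 1)"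
  by (metis in_Ints_iff_floor_eq_ceiling ceiling_altdef)

lemma walls_eq_if_mem_cell: "y \<in> cell x \<Longrightarrow> walls y = walls x"
  by (auto simp: cell_def walls_def in_Ints_iff_floor_eq_ceiling)

lemma bottom_cong: "y \<in> cell x \<Longrightarrow> bottom y v \<longleftrightarrow> bottom x v"
  by (simp add: cell_def bottom_def closed_cell_def)

lemma level_eq_on_walls:
  assumes "v \<in> closed_cell x" "H \<in> walls x"
  shows "level H v = level H x"
proof -
  have "H \<in> A" "level H x \<in> \<int>"
    using assms(2) by (auto simp: walls_def)
  then have "real_of_int \<lfloor>level H x\<rfloor> = level H x" "real_of_int \<lceil>level H x\<rceil> = level H x"
    by (auto elim: Ints_cases)
  then show ?thesis
    using assms(1) \<open>H \<in> A\<close> by (force simp: closed_cell_def)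
qed

lemma walls_mono:
  assumes "v \<in> closed_cell x"
  shows "walls x \<subseteq> walls v"
  using level_eq_on_walls[OF assms] by (auto simp: walls_def)

text \<open>Levels on a closed cell range over a closed interval of length at most \<open>1\<close> with integer endpoints, so
an integer level can only be one of the endpoints.\<close>

lemma closed_cell_cases:
  assumes "v \<in> closed_cell x" "H \<in> A"
  obtains (interior) "level H v \<notin> \<int>" "\<lfloor>level H v\<rfloor> = \<lfloor>level H x\<rfloor>" "\<lceil>level H v\<rceil> = \<lceil>level H x\<rceil>"
      "\<lceil>level H x\<rceil> = \<lfloor>level H x\<rfloor> + 1"
  | (lower) "level H v = real_of_int \<lfloor>level H x\<rfloor>"
  | (upper) "level H v = real_of_int \<lceil>level H x\<rceil>"
proof -
  have le: "real_of_int \<lfloor>level H x\<rfloor> \<le> level H v" "level H v \<le> real_of_int \<lceil>level H x\<rceil>"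
    using assms by (auto simp: closed_cell_def)
  have c: "\<lceil>level H x\<rceil> = \<lfloor>level H x\<rfloor> \<or> \<lceil>level H x\<rceil> = \<lfloor>level H x\<rfloor> + 1"
    by (simp add: ceiling_eq_floor_if)
  show ?thesis
  proof (cases "level H v = real_of_int \<lfloor>level H x\<rfloor> \<or> level H v = real_of_int \<lceil>level H x\<rceil>")
    case False
    then have strict: "real_of_int \<lfloor>level H x\<rfloor> < level H v" "level H v < real_of_int \<lceil>level H x\<rceil>"
      using le by auto
    then have up: "\<lceil>level H x\<rceil> = \<lfloor>level H x\<rfloor> + 1"
      using c by auto
    then have "\<lfloor>level H v\<rfloor> = \<lfloor>level H x\<rfloor>" "\<lceil>level H v\<rceil> = \<lceil>level H x\<rceil>"
      by (intro floor_unique ceiling_unique; use strict up in linarith)+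
    with up show ?thesis
      by (intro interior) (auto simp: in_Ints_iff_floor_eq_ceiling)
  qed (use lower upper in blast)
qed

lemma small_perturbation:
  "\<exists>e>0. \<forall>H\<in>A. \<bar>e * (normal H \<bullet> d)\<bar> < 1 \<and>
      (level H v \<notin> \<int> \<longrightarrow> real_of_int \<lfloor>level H v\<rfloor> < level H v + e * (normal H \<bullet> d) \<and>
         level H v + e * (normal H \<bullet> d) < real_of_int \<lceil>level H v\<rceil>)"
proof -
  have "\<forall>\<^sub>F e in at_right (0::real). \<bar>e * (normal H \<bullet> d)\<bar> < 1 \<and>
      (level H v \<notin> \<int> \<longrightarrow> real_of_int \<lfloor>level H v\<rfloor> < level H v + e * (normal H \<bullet> d) \<and>
         level H v + e * (normal H \<bullet> d) < real_of_int \<lceil>level H v\<rceil>)" for H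
  proof -
    have "((\<lambda>e. \<bar>e * (normal H \<bullet> d)\<bar>) \<longlongrightarrow> \<bar>0 * (normal H \<bullet> d)\<bar>) (at_right 0)"
      by (intro tendsto_intros)
    then have 1: "\<forall>\<^sub>F e in at_right (0::real). \<bar>e * (normal H \<bullet> d)\<bar> < 1"
      by (rule order_tendstoD) simp
    have lim: "((\<lambda>e. level H v + e * (normal H \<bullet> d)) \<longlongrightarrow> level H v + 0 * (normal H \<bullet> d)) (at_right 0)"
      by (intro tendsto_intros)
    show ?thesis
    proof (cases "level H v \<in> \<int>")
      case True
      with 1 show ?thesis by simp
    next
      case False
      then have "real_of_int \<lfloor>level H v\<rfloor> < level H v" "level H v < real_of_int \<lceil>level H v\<rceil>"
        by (metis Ints_of_int of_int_floor_le order_less_le)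
           (metis False Ints_of_int le_of_int_ceiling order_less_le)
      then show ?thesis
        using 1 order_tendstoD[OF lim] False by (simp add: eventually_conj_iff)
    qed
  qed
  then have "\<forall>\<^sub>F e in at_right (0::real). \<forall>H\<in>A. \<bar>e * (normal H \<bullet> d)\<bar> < 1 \<and>
      (level H v \<notin> \<int> \<longrightarrow> real_of_int \<lfloor>level H v\<rfloor> < level H v + e * (normal H \<bullet> d) \<and>
         level H v + e * (normal H \<bullet> d) < real_of_int \<lceil>level H v\<rceil>)"
    by (intro eventually_ball_finite finite_A) auto
  then obtain b where "0 < b" and b: "\<forall>e>0. e < b \<longrightarrow> (\<forall>H\<in>A. \<bar>e * (normal H \<bullet> d)\<bar> < 1 \<and>
      (level H v \<notin> \<int> \<longrightarrow> real_of_int \<lfloor>level H v\<rfloor> < level H v + e * (normal H \<bullet> d) \<and>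
         level H v + e * (normal H \<bullet> d) < real_of_int \<lceil>level H v\<rceil>))"
    unfolding eventually_at_right_field by blast
  then show ?thesis
    using b[rule_format, of "b/2"] by (intro exI[of _ "b/2"]) auto
qed

text \<open>Only the hyperplanes through \<open>v\<close> can prevent a short step from staying in the closed cell, and they do
so only if the step leaves the interval of levels at the endpoint that \<open>v\<close> occupies.\<close>

lemma feasible_direction:
  assumes v: "v \<in> closed_cell x"
    and up: "\<And>H. H \<in> walls v \<Longrightarrow> 0 < normal H \<bullet> d \<Longrightarrow> level H v \<noteq> real_of_int \<lceil>level H x\<rceil>"
    and down: "\<And>H. H \<in> walls v \<Longrightarrow> normal H \<bullet> d < 0 \<Longrightarrow> level H v \<noteq> real_of_int \<lfloor>level H x\<rfloor>"
  shows "\<exists>t>0. v + t *\<^sub>R d \<in> closed_cell x"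
proof -
  obtain e where "0 < e" and e: "\<forall>H\<in>A. \<bar>e * (normal H \<bullet> d)\<bar> < 1 \<and>
      (level H v \<notin> \<int> \<longrightarrow> real_of_int \<lfloor>level H v\<rfloor> < level H v + e * (normal H \<bullet> d) \<and>
         level H v + e * (normal H \<bullet> d) < real_of_int \<lceil>level H v\<rceil>)"
    using small_perturbation by blast
  have "real_of_int \<lfloor>level H x\<rfloor> \<le> level H (v + e *\<^sub>R d) \<and>
        level H (v + e *\<^sub>R d) \<le> real_of_int \<lceil>level H x\<rceil>" if H: "H \<in> A" for H
  proof -
    have lev: "level H (v + e *\<^sub>R d) = level H v + e * (normal H \<bullet> d)"
      by (simp add: level_add)
    have one: "\<bar>e * (normal H \<bullet> d)\<bar> < 1"
      using e H by blast
    have fc: "\<lceil>level H x\<rceil> = \<lfloor>level H x\<rfloor> \<or> \<lceil>level H x\<rceil> = \<lfloor>level H x\<rfloor> + 1"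
      by (simp add: ceiling_eq_floor_if)
    from v H show ?thesis
    proof (cases rule: closed_cell_cases)
      case interior
      then show ?thesis
        using e H lev by force
    next
      case lower
      then have W: "H \<in> walls v"
        using H by (simp add: walls_def)
      with down lower have "0 \<le> normal H \<bullet> d"
        by fastforce
      moreover have "\<lceil>level H x\<rceil> = \<lfloor>level H x\<rfloor> + 1" if "0 < normal H \<bullet> d"
        using up[OF W that] lower fc by auto
      ultimately show ?thesis
        using lower lev one \<open>0 < e\<close> by (cases "normal H \<bullet> d = 0") auto
    next
      case upper
      then have W: "H \<in> walls v"
        using H by (simp add: walls_def)
      with up upper have "normal H \<bullet> d \<le> 0"
        by fastforce
      moreover have "\<lceil>level H x\<rceil> = \<lfloor>level H x\<rfloor> + 1" if "normal H \<bullet> d < 0"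
        using down[OF W that] upper fc by auto
      moreover have "e * (normal H \<bullet> d) \<le> 0"
        using \<open>0 < e\<close> calculation(1) by (simp add: mult_nonneg_nonpos)
      ultimately show ?thesis
        using upper lev one by (cases "normal H \<bullet> d = 0") auto
    qed
  qed
  then show ?thesis
    using \<open>0 < e\<close> by (auto simp: closed_cell_def)
qed

lemma bottom_feasible_direction:
  assumes "bottom x v"
    and "\<And>H. H \<in> walls v \<Longrightarrow> 0 < normal H \<bullet> d \<Longrightarrow> level H v \<noteq> real_of_int \<lceil>level H x\<rceil>"
    and "\<And>H. H \<in> walls v \<Longrightarrow> normal H \<bullet> d < 0 \<Longrightarrow> level H v \<noteq> real_of_int \<lfloor>level H x\<rfloor>"
  shows "0 \<le> height \<bullet> d"
proof -
  obtain t where "0 < t" "v + t *\<^sub>R d \<in> closed_cell x"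
    using feasible_direction[of v x d] assms by (auto simp: bottom_def)
  then have "height \<bullet> v \<le> height \<bullet> (v + t *\<^sub>R d)"
    using assms(1) by (auto simp: bottom_def)
  then show ?thesis
    using \<open>0 < t\<close> by (simp add: inner_right_distrib zero_le_mult_iff)
qed

text \<open>If fewer than \<open>DIM('e)\<close> hyperplanes passed through the minimum point, then by genericity they would
leave a common direction along which the height is not constant, and both it and its opposite would be
feasible.\<close>

lemma bottom_is_vertex:
  assumes "bottom x v"
  shows "card (walls v) = DIM('e)"
proof (rule ccontr)
  assume "card (walls v) \<noteq> DIM('e)"
  then have "card (walls v) < DIM('e)"
    using card_walls_le[of v] by linarith
  then obtain d where d: "\<forall>H\<in>walls v. normal H \<bullet> d = 0" "height \<bullet> d \<noteq> 0"
    using exists_orthogonal_nonzero_inner[OF generic[OF walls_subset]] by blast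
  have "0 \<le> height \<bullet> d"
    using assms d(1) by (intro bottom_feasible_direction[of x v]) auto
  moreover have "0 \<le> height \<bullet> (- d)"
    using assms d(1) by (intro bottom_feasible_direction[of x v]) auto
  ultimately show False
    using d(2) by simp
qed

text \<open>The midpoint of two minimum points is a minimum point, hence a vertex. A hyperplane through it has
its level at an extreme value there, so the level is the same at both points; the normals at a
vertex separate points.\<close>

lemma bottom_unique:
  assumes v: "bottom x v" and w: "bottom x w"
  shows "v = w"
proof -
  define m where "m = (1/2) *\<^sub>R v + (1/2) *\<^sub>R w"
  have lev: "level H m = (level H v + level H w) / 2" for H
    by (simp add: m_def level_def inner_right_distrib field_simps)
  have "height \<bullet> v = height \<bullet> w"
    using v w by (auto simp: bottom_def intro: order_antisym)
  then have "height \<bullet> m = height \<bullet> v"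
    by (simp add: m_def inner_right_distrib)
  moreover have m: "m \<in> closed_cell x"
    using v w by (force simp: bottom_def closed_cell_def lev)
  ultimately have "bottom x m"
    using v by (simp add: bottom_def)
  then have "card (walls m) = DIM('e)"
    by (rule bottom_is_vertex)
  moreover have "normal H \<bullet> (v - w) = 0" if "H \<in> walls m" for H
  proof -
    have H: "H \<in> A" "level H m \<in> \<int>"
      using that by (auto simp: walls_def)
    then have "real_of_int \<lfloor>level H x\<rfloor> \<le> level H u \<and> level H u \<le> real_of_int \<lceil>level H x\<rceil>"
      if "u = v \<or> u = w" for u
      using that v w by (auto simp: bottom_def closed_cell_def)
    then have bnd: "real_of_int \<lfloor>level H x\<rfloor> \<le> level H v" "level H v \<le> real_of_int \<lceil>level H x\<rceil>"
      "real_of_int \<lfloor>level H x\<rfloor> \<le> level H w" "level H w \<le> real_of_int \<lceil>level H x\<rceil>"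
      by auto
    have "level H v = level H w"
      using m H(1)
    proof (cases rule: closed_cell_cases)
      case interior
      then show ?thesis
        using H by simp
    qed (use bnd lev[of H] in argo)+
    then show ?thesis
      by (simp add: level_def inner_diff_right)
  qed
  ultimately have "v - w = 0"
    using vertex_normals[of m "v - w"] by blast
  then show ?thesis
    by simp
qed

text \<open>The basis dual to the normals at a vertex. Its members are the directions of the edges through the
vertex, and by genericity none of these edges is horizontal.\<close>

lemma vertex_edges:
  assumes v: "card (walls v) = DIM('e)"
  obtains edge where
    "\<And>H H'. H \<in> walls v \<Longrightarrow> H' \<in> walls v \<Longrightarrow> normal H \<bullet> edge H' = (if H = H' then 1 else 0)"
    "\<And>H. H \<in> walls v \<Longrightarrow> height \<bullet> edge H \<noteq> 0"
    "\<And>y. y = (\<Sum>H\<in>walls v. (normal H \<bullet> y) *\<^sub>R edge H)"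
proof -
  have "\<exists>d. normal H \<bullet> d = 1 \<and> (\<forall>H'\<in>walls v - {H}. normal H' \<bullet> d = 0) \<and> height \<bullet> d \<noteq> 0"
    if H: "H \<in> walls v" for H
  proof -
    \<comment> \<open>Genericity, applied to the other \<open>DIM('e) - 1\<close> hyperplanes, yields a non-horizontal direction
      along their intersection; it has to cross \<open>H\<close>.\<close>
    have "card (walls v - {H}) < DIM('e)"
      using v H finite_walls by (metis card_Diff1_less)
    moreover have "walls v - {H} \<subseteq> A"
      using walls_subset by blast
    ultimately have "height \<notin> span (normal ` (walls v - {H}))"
      by (intro generic)
    from exists_orthogonal_nonzero_inner[OF this]
    obtain d where d: "\<forall>H'\<in>walls v - {H}. normal H' \<bullet> d = 0" "height \<bullet> d \<noteq> 0"
      by auto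
    have "normal H \<bullet> d \<noteq> 0"
      using vertex_normals[OF v, of d] d by fastforce
    with d show ?thesis
      by (intro exI[of _ "(1 / (normal H \<bullet> d)) *\<^sub>R d"]) auto
  qed
  then have "\<exists>edge. \<forall>H\<in>walls v. normal H \<bullet> edge H = 1 \<and>
      (\<forall>H'\<in>walls v - {H}. normal H' \<bullet> edge H = 0) \<and> height \<bullet> edge H \<noteq> 0"
    by (intro bchoice) blast
  then obtain edge where edge: "\<And>H. H \<in> walls v \<Longrightarrow> normal H \<bullet> edge H = 1 \<and>
      (\<forall>H'\<in>walls v - {H}. normal H' \<bullet> edge H = 0) \<and> height \<bullet> edge H \<noteq> 0"
    by blast
  then have dual: "normal H \<bullet> edge H' = (if H = H' then 1 else 0)"
    if "H \<in> walls v" "H' \<in> walls v" for H H'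
    using that by auto
  have "y - (\<Sum>H\<in>walls v. (normal H \<bullet> y) *\<^sub>R edge H) = 0" for y
  proof (rule vertex_normals[OF v])
    fix H
    assume H: "H \<in> walls v"
    have "normal H \<bullet> (\<Sum>H'\<in>walls v. (normal H' \<bullet> y) *\<^sub>R edge H')
        = (\<Sum>H'\<in>walls v. if H = H' then normal H' \<bullet> y else 0)"
      unfolding inner_sum_right using dual[OF H] by (intro sum.cong) auto
    then show "normal H \<bullet> (y - (\<Sum>H'\<in>walls v. (normal H' \<bullet> y) *\<^sub>R edge H')) = 0"
      using H finite_walls by (simp add: inner_diff_right)
  qed
  then have "y = (\<Sum>H\<in>walls v. (normal H \<bullet> y) *\<^sub>R edge H)" for y
    by (metis eq_iff_diff_eq_0)
  from dual _ this show thesis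
    by (rule that) (use edge in auto)
qed

text \<open>The levels with respect to the hyperplanes at any one vertex are affine coordinates, and on a closed
cell they are bounded.\<close>

lemma compact_closed_cell: "compact (closed_cell x)"
proof -
  obtain v where v: "card (walls v) = DIM('e)"
    using vertex_exists by blast
  obtain edge where
    "\<And>H H'. H \<in> walls v \<Longrightarrow> H' \<in> walls v \<Longrightarrow> normal H \<bullet> edge H' = (if H = H' then 1 else 0)"
    "\<And>H. H \<in> walls v \<Longrightarrow> height \<bullet> edge H \<noteq> 0"
    and edge: "\<And>y. y = (\<Sum>H\<in>walls v. (normal H \<bullet> y) *\<^sub>R edge H)"
    by (rule vertex_edges[OF v]) blast
  have "norm (y - x) \<le> (\<Sum>H\<in>walls v. norm (edge H))" if y: "y \<in> closed_cell x" for y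
  proof -
    have "norm ((normal H \<bullet> (y - x)) *\<^sub>R edge H) \<le> norm (edge H)" if "H \<in> walls v" for H
    proof -
      have "H \<in> A"
        using that walls_subset by blast
      then have "real_of_int \<lfloor>level H x\<rfloor> \<le> level H y" "level H y \<le> real_of_int \<lceil>level H x\<rceil>"
        using y by (auto simp: closed_cell_def)
      moreover have "normal H \<bullet> (y - x) = level H y - level H x"
        by (simp add: level_def inner_diff_right)
      ultimately have "\<bar>normal H \<bullet> (y - x)\<bar> \<le> 1"
        by linarith
      then show ?thesis
        by (simp add: mult_left_le_one_le)
    qed
    then show ?thesis
      by (subst edge[of "y - x"]) (rule sum_norm_le)
  qed
  then have "bounded (closed_cell x)"
    by (intro boundedI[of _ "norm x + (\<Sum>H\<in>walls v. norm (edge H))"])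
       (smt (verit, ccfv_SIG) norm_triangle_sub)
  moreover have "closed (closed_cell x)"
  proof -
    have "closed_cell x = (\<Inter>H\<in>A. {y. real_of_int \<lfloor>level H x\<rfloor> \<le> level H y} \<inter>
        {y. level H y \<le> real_of_int \<lceil>level H x\<rceil>})"
      by (auto simp: closed_cell_def)
    also have "closed \<dots>"
      unfolding level_def
      by (intro closed_INT ballI closed_Int closed_Collect_le continuous_intros)
    finally show ?thesis .
  qed
  ultimately show ?thesis
    by (simp add: compact_eq_bounded_closed)
qed

lemma bottom_exists: "\<exists>v. bottom x v"
proof -
  have "\<exists>v\<in>closed_cell x. \<forall>y\<in>closed_cell x. height \<bullet> v \<le> height \<bullet> y"
    using self_in_closed_cell compact_closed_cell
    by (intro continuous_attains_inf continuous_intros) auto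
  then show ?thesis
    by (auto simp: bottom_def)
qed

text \<open>A hyperplane that misses \<open>v\<close> has the same floor and ceiling on the cell as at \<open>v\<close>. For a hyperplane
through \<open>v\<close> that does not contain the cell, the cell has to lie on the side to which the
corresponding edge ascends, since otherwise that edge would lead down from \<open>v\<close>.\<close>

lemma cell_determined_by_bottom:
  assumes x: "bottom x v" and y: "bottom y v" and w: "walls x = walls y"
  shows "y \<in> cell x"
proof -
  have vx: "v \<in> closed_cell x" and vy: "v \<in> closed_cell y"
    using x y by (auto simp: bottom_def)
  obtain edge where
    dual: "\<And>H H'. H \<in> walls v \<Longrightarrow> H' \<in> walls v \<Longrightarrow> normal H \<bullet> edge H' = (if H = H' then 1 else 0)"
    and nz: "\<And>H. H \<in> walls v \<Longrightarrow> height \<bullet> edge H \<noteq> 0"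
    and "\<And>y. y = (\<Sum>H\<in>walls v. (normal H \<bullet> y) *\<^sub>R edge H)"
    by (rule vertex_edges[OF bottom_is_vertex[OF x]]) blast
  have side: "(if 0 < height \<bullet> edge H then level H v = real_of_int \<lfloor>level H u\<rfloor>
      else level H v = real_of_int \<lceil>level H u\<rceil>)" if u: "bottom u v" and H: "H \<in> walls v" for u H
  proof -
    have HA: "H \<in> A" and int: "level H v \<in> \<int>"
      using H by (auto simp: walls_def)
    have vu: "v \<in> closed_cell u"
      using u by (simp add: bottom_def)
    from vu HA show ?thesis
    proof (cases rule: closed_cell_cases)
      case interior
      with int show ?thesis by simp
    next
      case lower
      have "0 \<le> height \<bullet> edge H" if "level H v \<noteq> real_of_int \<lceil>level H u\<rceil>"
        using u that dual[OF _ H] by (intro bottom_feasible_direction[of u v]) (auto split: if_splits)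
      then show ?thesis
        using lower nz[OF H] by force
    next
      case upper
      have "0 \<le> height \<bullet> (- edge H)" if "level H v \<noteq> real_of_int \<lfloor>level H u\<rfloor>"
        using u that dual[OF _ H] by (intro bottom_feasible_direction[of u v]) (auto split: if_splits)
      then show ?thesis
        using upper by force
    qed
  qed
  have floor_ceiling: "\<lfloor>level H v\<rfloor> = \<lfloor>level H u\<rfloor> \<and> \<lceil>level H v\<rceil> = \<lceil>level H u\<rceil>"
    if "v \<in> closed_cell u" "H \<in> A" "level H v \<notin> \<int>" for u H
    using that(1,2) by (cases rule: closed_cell_cases) (use that(3) in auto)
  have "\<lfloor>level H y\<rfloor> = \<lfloor>level H x\<rfloor> \<and> \<lceil>level H y\<rceil> = \<lceil>level H x\<rceil>" if H: "H \<in> A" for H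
  proof (cases "H \<in> walls v")
    case False
    then have "level H v \<notin> \<int>"
      using H by (simp add: walls_def)
    then show ?thesis
      using floor_ceiling[OF vx H] floor_ceiling[OF vy H] by simp
  next
    case True
    have fx: "\<lceil>level H x\<rceil> = (if H \<in> walls x then \<lfloor>level H x\<rfloor> else \<lfloor>level H x\<rfloor> + 1)"
      "\<lceil>level H y\<rceil> = (if H \<in> walls y then \<lfloor>level H y\<rfloor> else \<lfloor>level H y\<rfloor> + 1)"
      using H by (simp_all add: walls_def ceiling_eq_floor_if)
    then show ?thesis
      using side[OF x True] side[OF y True] w by (auto split: if_splits)
  qed
  then show ?thesis
    by (simp add: cell_def)
qed

text \<open>Starting at \<open>v\<close>, move a little upwards along each edge that belongs to a hyperplane outside \<open>T\<close>.\<close>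

lemma cell_above_vertex:
  assumes v: "card (walls v) = DIM('e)" and T: "T \<subseteq> walls v"
  shows "\<exists>x. bottom x v \<and> walls x = T"
proof -
  obtain edge where
    dual: "\<And>H H'. H \<in> walls v \<Longrightarrow> H' \<in> walls v \<Longrightarrow> normal H \<bullet> edge H' = (if H = H' then 1 else 0)"
    and nz: "\<And>H. H \<in> walls v \<Longrightarrow> height \<bullet> edge H \<noteq> 0"
    and basis: "\<And>y. y = (\<Sum>H\<in>walls v. (normal H \<bullet> y) *\<^sub>R edge H)"
    by (rule vertex_edges[OF v]) blast
  define s where "s H = (if H \<in> T then 0 else sgn (height \<bullet> edge H))" for H
  define d where "d = (\<Sum>H\<in>walls v. s H *\<^sub>R edge H)"
  have d: "normal H \<bullet> d = s H" if "H \<in> walls v" for H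
  proof -
    have "normal H \<bullet> d = (\<Sum>H'\<in>walls v. if H = H' then s H' else 0)"
      unfolding d_def inner_sum_right using dual[OF that] by (intro sum.cong) auto
    then show ?thesis
      using that finite_walls by simp
  qed
  obtain e where "0 < e" and e: "\<forall>H\<in>A. \<bar>e * (normal H \<bullet> d)\<bar> < 1 \<and>
      (level H v \<notin> \<int> \<longrightarrow> real_of_int \<lfloor>level H v\<rfloor> < level H v + e * (normal H \<bullet> d) \<and>
         level H v + e * (normal H \<bullet> d) < real_of_int \<lceil>level H v\<rceil>)"
    using small_perturbation by blast
  define x where "x = v + e *\<^sub>R d"
  have lev: "level H x = level H v + e * (normal H \<bullet> d)" for H
    by (simp add: x_def level_add)
  have off: "\<lfloor>level H x\<rfloor> = \<lfloor>level H v\<rfloor>" "\<lceil>level H x\<rceil> = \<lceil>level H v\<rceil>" "level H x \<notin> \<int>"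
    if "H \<in> A" "H \<notin> walls v" for H
  proof -
    have ni: "level H v \<notin> \<int>"
      using that by (simp add: walls_def)
    have b: "real_of_int \<lfloor>level H v\<rfloor> < level H x" "level H x < real_of_int \<lceil>level H v\<rceil>"
      using e that ni lev by auto
    have "\<lceil>level H v\<rceil> = \<lfloor>level H v\<rfloor> + 1"
      using ni by (simp add: ceiling_eq_floor_if)
    with b show "\<lfloor>level H x\<rfloor> = \<lfloor>level H v\<rfloor>" "\<lceil>level H x\<rceil> = \<lceil>level H v\<rceil>"
      by (intro floor_unique ceiling_unique; linarith)+
    then show "level H x \<notin> \<int>"
      using ni by (simp add: in_Ints_iff_floor_eq_ceiling)
  qed
  have on: "level H x = level H v \<and> level H x \<in> \<int>" if "H \<in> T" for H
    using that T d[of H] by (auto simp: lev s_def walls_def)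
  have up: "\<lfloor>level H x\<rfloor> = level H v \<and> \<lceil>level H x\<rceil> = level H v + 1"
    if H: "H \<in> walls v" "H \<notin> T" "0 < height \<bullet> edge H" for H
  proof -
    have "normal H \<bullet> d = 1"
      using d H by (simp add: s_def)
    then have "e < 1" "level H x = level H v + e"
      using e H(1) lev walls_subset by fastforce+
    moreover obtain i where i: "level H v = of_int i"
      using H(1) by (auto simp: walls_def elim: Ints_cases)
    ultimately have "\<lfloor>level H x\<rfloor> = i" "\<lceil>level H x\<rceil> = i + 1"
      by (intro floor_unique ceiling_unique; use \<open>0 < e\<close> in simp)+
    then show ?thesis
      using i by simp
  qed
  have down: "\<lfloor>level H x\<rfloor> = level H v - 1 \<and> \<lceil>level H x\<rceil> = level H v"
    if H: "H \<in> walls v" "H \<notin> T" "\<not> 0 < height \<bullet> edge H" for H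
  proof -
    have "normal H \<bullet> d = -1"
      using d[OF H(1)] H nz[OF H(1)] by (simp add: s_def)
    then have "e < 1" "level H x = level H v - e"
      using e H(1) lev walls_subset by fastforce+
    moreover obtain i where i: "level H v = of_int i"
      using H(1) by (auto simp: walls_def elim: Ints_cases)
    ultimately have "\<lfloor>level H x\<rfloor> = i - 1" "\<lceil>level H x\<rceil> = i"
      by (intro floor_unique ceiling_unique; use \<open>0 < e\<close> in simp)+
    then show ?thesis
      using i by simp
  qed
  have "v \<in> closed_cell x"
    unfolding closed_cell_def
  proof (intro CollectI ballI)
    fix H
    assume H: "H \<in> A"
    consider "H \<notin> walls v" | "H \<in> T" | "H \<in> walls v" "H \<notin> T" "0 < height \<bullet> edge H"
      | "H \<in> walls v" "H \<notin> T" "\<not> 0 < height \<bullet> edge H"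
      by blast
    then show "real_of_int \<lfloor>level H x\<rfloor> \<le> level H v \<and> level H v \<le> real_of_int \<lceil>level H x\<rceil>"
    proof cases
      case 1
      then show ?thesis using off[OF H] by simp
    next
      case 2
      then show ?thesis using on[OF 2] by (metis ceiling_correct of_int_floor_le)
    next
      case 3
      then show ?thesis using up[OF 3] by linarith
    next
      case 4
      then show ?thesis using down[OF 4] by linarith
    qed
  qed
  moreover have "height \<bullet> v \<le> height \<bullet> y" if y: "y \<in> closed_cell x" for y
  proof -
    \<comment> \<open>In the coordinates given by the edges, each summand pairs the displacement of \<open>y\<close> along an edge
      with the slope of that edge, and on the closed cell the two have the same sign.\<close>
    have "height \<bullet> (y - v) = (\<Sum>H\<in>walls v. (normal H \<bullet> (y - v)) * (height \<bullet> edge H))"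
      by (subst basis[of "y - v"]) (simp add: inner_sum_right)
    also have "\<dots> \<ge> 0"
    proof (rule sum_nonneg)
      fix H
      assume H: "H \<in> walls v"
      then have b: "real_of_int \<lfloor>level H x\<rfloor> \<le> level H y" "level H y \<le> real_of_int \<lceil>level H x\<rceil>"
        using y walls_subset by (auto simp: closed_cell_def)
      have n: "normal H \<bullet> (y - v) = level H y - level H v"
        by (simp add: level_def inner_diff_right)
      consider "H \<in> T" | "H \<notin> T" "0 < height \<bullet> edge H" | "H \<notin> T" "\<not> 0 < height \<bullet> edge H"
        by blast
      then show "0 \<le> (normal H \<bullet> (y - v)) * (height \<bullet> edge H)"
      proof cases
        case 1
        then have "H \<in> walls x"
          using on H by (simp add: walls_def)
        then have "level H y = level H x"
          by (rule level_eq_on_walls[OF y])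
        then show ?thesis
          using n on[OF 1] by simp
      next
        case 2
        then show ?thesis
          using up[OF H 2] n b by simp
      next
        case 3
        then show ?thesis
          using down[OF H 3] n b by (simp add: mult_nonpos_nonpos)
      qed
    qed
    finally show ?thesis
      by (simp add: inner_diff_right)
  qed
  moreover have "walls x = T"
  proof
    show "T \<subseteq> walls x"
      using on T walls_subset by (force simp: walls_def)
    have "H \<notin> walls x" if H: "H \<in> walls v" "H \<notin> T" for H
    proof -
      have "\<lfloor>level H x\<rfloor> \<noteq> \<lceil>level H x\<rceil>"
        using up[OF H] down[OF H] by (cases "0 < height \<bullet> edge H") auto
      then show ?thesis
        by (simp add: walls_def in_Ints_iff_floor_eq_ceiling)
    qed
    then show "walls x \<subseteq> T"
      using off(3) by (auto simp: walls_def)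
  qed
  ultimately show ?thesis
    unfolding bottom_def by blast
qed

text \<open>If all normals have integral inner product with \<open>z\<close>, then translation by \<open>z\<close> shifts every level by an
integer and hence respects all notions above.\<close>

lemma level_translate:
  assumes "H \<in> A" "\<And>H. H \<in> A \<Longrightarrow> normal H \<bullet> z \<in> \<int>"
  obtains m where "\<And>x. level H (x + z) = level H x + of_int m"
  using assms by (metis level_add Ints_cases)

lemma walls_translate:
  assumes "\<And>H. H \<in> A \<Longrightarrow> normal H \<bullet> z \<in> \<int>"
  shows "walls (x + z) = walls x"
proof -
  have "level H (x + z) \<in> \<int> \<longleftrightarrow> level H x \<in> \<int>" if "H \<in> A" for H
    using assms[OF that] by (metis level_add Ints_add Ints_diff add_diff_cancel_right')
  then show ?thesis
    by (auto simp: walls_def)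
qed

lemma cell_translate:
  assumes "\<And>H. H \<in> A \<Longrightarrow> normal H \<bullet> z \<in> \<int>" "y \<in> cell x"
  shows "y + z \<in> cell (x + z)"
proof -
  have "\<lfloor>level H (y + z)\<rfloor> = \<lfloor>level H (x + z)\<rfloor> \<and> \<lceil>level H (y + z)\<rceil> = \<lceil>level H (x + z)\<rceil>"
    if H: "H \<in> A" for H
  proof -
    obtain m where "\<And>x. level H (x + z) = level H x + of_int m"
      using level_translate[OF H assms(1)] by blast
    then show ?thesis
      using assms(2) H by (simp add: cell_def)
  qed
  then show ?thesis
    by (simp add: cell_def)
qed

lemma closed_cell_translate:
  assumes "\<And>H. H \<in> A \<Longrightarrow> normal H \<bullet> z \<in> \<int>" "y \<in> closed_cell x"
  shows "y + z \<in> closed_cell (x + z)"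
proof -
  have "real_of_int \<lfloor>level H (x + z)\<rfloor> \<le> level H (y + z) \<and>
        level H (y + z) \<le> real_of_int \<lceil>level H (x + z)\<rceil>"
    if H: "H \<in> A" for H
  proof -
    obtain m where "\<And>x. level H (x + z) = level H x + of_int m"
      using level_translate[OF H assms(1)] by blast
    then show ?thesis
      using assms(2) H by (simp add: closed_cell_def)
  qed
  then show ?thesis
    by (simp add: closed_cell_def)
qed

lemma bottom_translate:
  assumes z: "\<And>H. H \<in> A \<Longrightarrow> normal H \<bullet> z \<in> \<int>" and v: "bottom x v"
  shows "bottom (x + z) (v + z)"
  unfolding bottom_def
proof (intro conjI ballI)
  show "v + z \<in> closed_cell (x + z)"
    using v by (intro closed_cell_translate z) (simp_all add: bottom_def)
  fix y
  assume y: "y \<in> closed_cell (x + z)"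
  have "y + - z \<in> closed_cell (x + z + - z)"
    by (rule closed_cell_translate[OF _ y]) (use z in simp)
  then have "y - z \<in> closed_cell x"
    by simp
  then have "height \<bullet> v \<le> height \<bullet> (y - z)"
    using v by (simp add: bottom_def)
  then show "height \<bullet> (v + z) \<le> height \<bullet> y"
    by (simp add: inner_diff_right inner_right_distrib)
qed

lemma convex_cell: "convex (cell x)"
proof -
  have "cell x = (\<Inter>H\<in>A. {y. normal H \<bullet> y \<ge> real_of_int \<lfloor>level H x\<rfloor> + offset H} \<inter>
      {y. normal H \<bullet> y < real_of_int \<lfloor>level H x\<rfloor> + 1 + offset H} \<inter>
      {y. normal H \<bullet> y > real_of_int \<lceil>level H x\<rceil> - 1 + offset H} \<inter>
      {y. normal H \<bullet> y \<le> real_of_int \<lceil>level H x\<rceil> + offset H})"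
    unfolding cell_def level_def floor_eq_iff ceiling_eq_iff by (auto simp: algebra_simps)
  also have "convex \<dots>"
    by (intro convex_INT convex_Int convex_halfspace_le convex_halfspace_ge
        convex_halfspace_lt convex_halfspace_gt)
  finally show ?thesis .
qed

text \<open>Among the points with the same walls, the cell of \<open>x\<close> is cut out by strict inequalities: on a wall
of \<open>x\<close> the levels are integers, so it is enough that they differ by less than \<open>1\<close>.\<close>

lemma cell_relatively_open:
  "\<exists>U. open U \<and> cell x = U \<inter> {y. walls y = walls x}"
proof -
  define lo hi where "lo H = (if H \<in> walls x then level H x - 1 else real_of_int \<lfloor>level H x\<rfloor>)"
    and "hi H = (if H \<in> walls x then level H x + 1 else real_of_int \<lceil>level H x\<rceil>)" for H
  define U where "U = (\<Inter>H\<in>A. {y. lo H < level H y} \<inter> {y. level H y < hi H})"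
  have open_U: "open U"
    unfolding U_def level_def
    by (intro open_INT finite_A ballI open_Int open_Collect_less continuous_intros)
  have bounds: "lo H < level H y \<and> level H y < hi H \<longleftrightarrow>
      \<lfloor>level H y\<rfloor> = \<lfloor>level H x\<rfloor> \<and> \<lceil>level H y\<rceil> = \<lceil>level H x\<rceil>"
    if H: "H \<in> A" and w: "walls y = walls x" for H y
  proof (cases "H \<in> walls x")
    case True
    with w H obtain i j where "level H x = of_int i" "level H y = of_int j"
      by (fastforce simp: walls_def elim: Ints_cases)
    then show ?thesis
      using True by (simp add: lo_def hi_def) linarith
  next
    case False
    with w H have ni: "level H x \<notin> \<int>" "level H y \<notin> \<int>"
      by (auto simp: walls_def)
    then have "real_of_int \<lfloor>level H y\<rfloor> < level H y"
      by (metis Ints_of_int of_int_floor_le order_less_le)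
    then have "real_of_int \<lfloor>level H x\<rfloor> < level H y \<and> level H y < real_of_int \<lfloor>level H x\<rfloor> + 1 \<longleftrightarrow>
        \<lfloor>level H y\<rfloor> = \<lfloor>level H x\<rfloor>"
      by (metis floor_eq_iff order_less_imp_le)
    then show ?thesis
      using False ni by (simp add: lo_def hi_def ceiling_eq_floor_if)
  qed
  have "y \<in> cell x \<longleftrightarrow> y \<in> U" if "walls y = walls x" for y
    using bounds[OF _ that] by (simp add: cell_def U_def)
  then have "cell x = U \<inter> {y. walls y = walls x}"
    using walls_eq_if_mem_cell by blast
  with open_U show ?thesis
    by blast
qed

end

section \<open>Flats on the torus as images of cells\<close>

text \<open>For a connected component that meets two parts, one part and the union of the others would be a
separation.\<close>

lemma components_eq_open_partition:
  assumes part: "\<Union>P = X" "\<And>C D. C \<in> P \<Longrightarrow> D \<in> P \<Longrightarrow> C \<inter> D \<noteq> {} \<Longrightarrow> C = D"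
    and conn: "\<And>C. C \<in> P \<Longrightarrow> connected C \<and> C \<noteq> {}"
    and op: "\<And>C. C \<in> P \<Longrightarrow> \<exists>U. open U \<and> C = U \<inter> X"
  shows "components X = P"
proof -
  have comp: "connected_component_set X x = C" if C: "C \<in> P" "x \<in> C" for C x
  proof
    show "C \<subseteq> connected_component_set X x"
      using C part(1) conn by (intro connected_component_maximal) auto
    obtain U where U: "open U" "C = U \<inter> X"
      using op C by blast
    have "\<exists>V. open V \<and> D = V \<inter> X" if "D \<in> P" for D
      using op that by blast
    then obtain V where V: "\<And>D. D \<in> P \<Longrightarrow> open (V D) \<and> D = V D \<inter> X"
      by metis
    define W where "W = (\<Union>D\<in>P - {C}. V D)"
    have "open W"
      using V by (auto simp: W_def)
    have "X \<subseteq> U \<union> W"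
      using part(1) U V by (fastforce simp: W_def)
    have "U \<inter> W \<inter> X = {}"
    proof (rule ccontr)
      assume "U \<inter> W \<inter> X \<noteq> {}"
      then obtain p D where "p \<in> U \<inter> X" "D \<in> P" "D \<noteq> C" "p \<in> V D \<inter> X"
        by (auto simp: W_def)
      then have "p \<in> C \<inter> D" "D \<in> P" "D \<noteq> C"
        using U V by auto
      then show False
        using part(2)[OF C(1)] by blast
    qed
    let ?K = "connected_component_set X x"
    have K: "?K \<subseteq> X" "connected ?K" "x \<in> ?K"
      using C part(1) connected_component_subset by auto
    have "U \<inter> ?K = {} \<or> W \<inter> ?K = {}"
      using K connectedD[OF K(2) \<open>open U\<close> \<open>open W\<close>] \<open>X \<subseteq> U \<union> W\<close> \<open>U \<inter> W \<inter> X = {}\<close> by blast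
    moreover have "x \<in> U \<inter> ?K"
      using U C K by auto
    ultimately show "?K \<subseteq> C"
      using K U \<open>X \<subseteq> U \<union> W\<close> by blast
  qed
  show ?thesis
  proof
    show "components X \<subseteq> P"
      using comp part(1) by (auto simp: components_def)
    show "P \<subseteq> components X"
    proof
      fix C
      assume C: "C \<in> P"
      then obtain x where "x \<in> C"
        using conn by blast
      then show "C \<in> components X"
        using comp[OF C] part(1) C by (auto simp: components_def)
    qed
  qed
qed

lemma to_torus_eq_iff: "to_torus x = to_torus y \<longleftrightarrow> (\<forall>i. (x - y) $ i \<in> \<int>)"
  by (simp add: torus.abs_eq_iff congruent_Zn_def)

lemma to_torus_cases: obtains x where "p = to_torus x"
  by (induction p rule: torus.abs_induct) blast

lemma continuous_on_to_torus: "continuous_on S to_torus"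
proof -
  have "continuous_on UNIV to_torus"
    by (simp add: continuous_on_open_vimage open_torus_def)
  then show ?thesis
    by (rule continuous_on_subset) simp
qed

text \<open>The projection is open because the preimage of an image is a union of integer translates.\<close>

lemma open_to_torus_image:
  assumes "open U"
  shows "open (to_torus ` U)"
proof -
  have "to_torus -` to_torus ` U = (\<Union>z\<in>{z. \<forall>i. z $ i \<in> \<int>}. (+) z ` U)"
  proof (intro equalityI subsetI)
    fix x
    assume "x \<in> to_torus -` to_torus ` U"
    then obtain y where "y \<in> U" "to_torus x = to_torus y"
      by auto
    then have "x - y \<in> {z. \<forall>i. z $ i \<in> \<int>}" "x = (x - y) + y"
      using to_torus_eq_iff by auto
    then show "x \<in> (\<Union>z\<in>{z. \<forall>i. z $ i \<in> \<int>}. (+) z ` U)"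
      using \<open>y \<in> U\<close> by blast
  next
    fix x
    assume "x \<in> (\<Union>z\<in>{z. \<forall>i. z $ i \<in> \<int>}. (+) z ` U)"
    then obtain z y where "\<forall>i. z $ i \<in> \<int>" "y \<in> U" "x = z + y"
      by auto
    then have "to_torus x = to_torus y"
      by (simp add: to_torus_eq_iff)
    then show "x \<in> to_torus -` to_torus ` U"
      using \<open>y \<in> U\<close> by auto
  qed
  also have "open \<dots>"
    using assms by (intro open_UN ballI open_translation)
  finally show ?thesis
    by (simp add: open_torus_def)
qed

definition members_at :: "'n::finite torus set set \<Rightarrow> 'n torus \<Rightarrow> 'n torus set set"
  where "members_at A p = {H \<in> A. p \<in> H}"

text \<open>The recursion for flats removes from \<open>\<Inter>S\<close> the points that lie on too many hyperplanes. By induction the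
union of all flats of dimension \<open>j\<close> consists of the points that lie on exactly \<open>n - j\<close> hyperplanes, so
what remains of \<open>\<Inter>S\<close> are the points that lie on the hyperplanes in \<open>S\<close> and on no others.\<close>

lemma flats_eq_strata:
  fixes A :: "'n::finite torus set set"
  assumes fin: "finite A" and card_le: "\<And>p. card (members_at A p) \<le> CARD('n)"
    and "k \<le> CARD('n)"
  shows "flats A k = (\<Union>S\<in>{S. S \<subseteq> A \<and> card S = CARD('n) - k}. components {p. members_at A p = S})"
  using \<open>k \<le> CARD('n)\<close>
proof (induction k rule: less_induct)
  case (less k)
  let ?n = "CARD('n)"
  have mem: "p \<in> \<Inter>S \<longleftrightarrow> S \<subseteq> members_at A p" if "S \<subseteq> A" for p S
    using that by (auto simp: members_at_def)
  have fin_mem: "finite (members_at A p)" for p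
    using fin by (simp add: members_at_def)
  have eqI: "S = members_at A p" if "S \<subseteq> members_at A p" "card (members_at A p) \<le> card S" for p S
    using card_seteq[OF fin_mem that] .
  consider "k = 0" | "0 < k" "k < ?n" | "k = ?n" "0 < k"
    using less.prems by fastforce
  then show ?case
  proof cases
    case 1
    have "\<Inter>S = {p. members_at A p = S}" if "S \<subseteq> A" "card S = ?n" for S
      using mem[OF that(1)] eqI[of S] card_le that(2) by fastforce
    then show ?thesis
      using 1 by (subst flats.simps) auto
  next
    case 2
    have Union_flats: "\<Union>(flats A j) = {p. card (members_at A p) = ?n - j}" if "j < k" for j
    proof -
      have "flats A j = (\<Union>S\<in>{S. S \<subseteq> A \<and> card S = ?n - j}. components {p. members_at A p = S})"
        using less.IH[OF that] that less.prems by simp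
      then have "\<Union>(flats A j) = (\<Union>S\<in>{S. S \<subseteq> A \<and> card S = ?n - j}. \<Union>(components {p. members_at A p = S}))"
        by blast
      also have "\<dots> = {p. card (members_at A p) = ?n - j}"
        by (auto simp: Union_components[symmetric]) (auto simp: members_at_def)
      finally show ?thesis .
    qed
    have "\<Inter>S - (\<Union>j\<in>{..<k}. \<Union>(flats A j)) = {p. members_at A p = S}"
      if S: "S \<subseteq> A" "card S = ?n - k" for S
    proof (intro equalityI subsetI)
      fix p
      assume p: "p \<in> \<Inter>S - (\<Union>j\<in>{..<k}. \<Union>(flats A j))"
      have "card (members_at A p) \<le> ?n - k"
      proof (rule ccontr)
        assume "\<not> ?thesis"
        then have "?n - card (members_at A p) < k" "card (members_at A p) = ?n - (?n - card (members_at A p))"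
          using card_le[of p] 2 by auto
        then show False
          using p Union_flats by blast
      qed
      then show "p \<in> {p. members_at A p = S}"
        using eqI[of S p] p mem[OF S(1)] S(2) by auto
    next
      fix p
      assume "p \<in> {p. members_at A p = S}"
      then show "p \<in> \<Inter>S - (\<Union>j\<in>{..<k}. \<Union>(flats A j))"
        using mem[OF S(1)] Union_flats S(2) 2 by auto
    qed
    then show ?thesis
      using 2 by (subst flats.simps) auto
  next
    case 3
    have "{S. S \<subseteq> A \<and> card S = ?n - k} = {{}}"
      using 3 fin finite_subset by fastforce
    moreover have "UNIV - \<Union>A = {p. members_at A p = {}}"
      by (auto simp: members_at_def)
    ultimately show ?thesis
      using 3 by (subst flats.simps) simp
  qed
qed

locale toric_lift = generic_arrangement A normal offset height level walls
  for A :: "'n::finite torus set set" and normal :: "'n torus set \<Rightarrow> real ^ 'n"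
    and offset height level walls +
  assumes normal_integral: "H \<in> A \<Longrightarrow> (\<And>i. z $ i \<in> \<int>) \<Longrightarrow> normal H \<bullet> z \<in> \<int>"
    and mem_iff_level: "H \<in> A \<Longrightarrow> to_torus x \<in> H \<longleftrightarrow> level H x \<in> \<int>"
begin

lemma members_at_to_torus: "members_at A (to_torus x) = walls x"
  using mem_iff_level by (auto simp: members_at_def walls_def)

text \<open>The images of cells are connected because cells are convex; they are open in their stratum because
cells are so upstairs and the projection is an open map; and two of them that meet are equal because
the cells upstairs differ by an integer translation.\<close>

lemma components_stratum:
  "components {p. members_at A p = S} = {to_torus ` cell x | x. walls x = S}"
proof (rule components_eq_open_partition)
  show "\<Union>{to_torus ` cell x | x. walls x = S} = {p. members_at A p = S}"
  proof (intro equalityI subsetI)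
    fix p
    assume "p \<in> \<Union>{to_torus ` cell x | x. walls x = S}"
    then obtain x y where "walls x = S" "y \<in> cell x" "p = to_torus y"
      by blast
    then show "p \<in> {p. members_at A p = S}"
      using walls_eq_if_mem_cell by (simp add: members_at_to_torus)
  next
    fix p
    assume p: "p \<in> {p. members_at A p = S}"
    obtain x where x: "p = to_torus x"
      by (rule to_torus_cases)
    then have "walls x = S"
      using p by (simp add: members_at_to_torus)
    moreover have "p \<in> to_torus ` cell x"
      using x self_in_cell by blast
    ultimately show "p \<in> \<Union>{to_torus ` cell x | x. walls x = S}"
      by blast
  qed
next
  fix C
  assume "C \<in> {to_torus ` cell x | x. walls x = S}"
  then obtain x where C: "C = to_torus ` cell x" "walls x = S"
    by blast
  show "connected C \<and> C \<noteq> {}"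
    using C self_in_cell convex_connected[OF convex_cell]
    by (auto intro: connected_continuous_image continuous_on_to_torus)
  obtain U where U: "open U" "cell x = U \<inter> {y. walls y = S}"
    using cell_relatively_open[of x] C by auto
  have "C = to_torus ` U \<inter> {p. members_at A p = S}"
    using C U by (auto simp: members_at_to_torus)
  then show "\<exists>U. open U \<and> C = U \<inter> {p. members_at A p = S}"
    using open_to_torus_image[OF U(1)] by blast
next
  fix C D
  assume "C \<in> {to_torus ` cell x | x. walls x = S}" "D \<in> {to_torus ` cell x | x. walls x = S}"
    and "C \<inter> D \<noteq> {}"
  then obtain x y x' y' where xy: "C = to_torus ` cell x" "D = to_torus ` cell x'"
      "y \<in> cell x" "y' \<in> cell x'" "to_torus y = to_torus y'"
    by blast
  have *: "to_torus ` cell u \<subseteq> to_torus ` cell u'" if "to_torus u = to_torus u'" for u u'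
  proof
    fix p
    assume "p \<in> to_torus ` cell u"
    then obtain w where w: "w \<in> cell u" "p = to_torus w"
      by blast
    have int: "\<And>i. (u' - u) $ i \<in> \<int>"
      using that to_torus_eq_iff by metis
    have "w + (u' - u) \<in> cell (u + (u' - u))"
      by (rule cell_translate[OF normal_integral w(1)]) (use int in auto)
    moreover have "to_torus (w + (u' - u)) = p"
      using int w(2) by (simp add: to_torus_eq_iff)
    ultimately show "p \<in> to_torus ` cell u'"
      by auto
  qed
  show "C = D"
    using *[OF xy(5)] *[OF xy(5)[symmetric]] xy cell_eq_if_mem by auto
qed

lemma flats_eq_cells:
  assumes "k \<le> CARD('n)"
  shows "flats A k = {to_torus ` cell x | x. card (walls x) = CARD('n) - k}"
proof -
  have "card (members_at A p) \<le> CARD('n)" for p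
    using card_walls_le by (induction p rule: torus.abs_induct) (simp add: members_at_to_torus)
  then have "flats A k = (\<Union>S\<in>{S. S \<subseteq> A \<and> card S = CARD('n) - k}. {to_torus ` cell x | x. walls x = S})"
    using flats_eq_strata[OF finite_A _ assms] by (simp add: components_stratum)
  also have "\<dots> = {to_torus ` cell x | x. card (walls x) = CARD('n) - k}"
    using walls_subset by (intro equalityI subsetI) (clarsimp, metis)+
  finally show ?thesis .
qed

section \<open>Flats and subsets of the hyperplanes through a vertex\<close>

definition vertex_flags :: "nat \<Rightarrow> ('n torus \<times> 'n torus set set) set"
  where "vertex_flags j =
    {(p, T). card (members_at A p) = CARD('n) \<and> T \<subseteq> members_at A p \<and> card T = j}"

definition flat_above :: "'n torus \<times> 'n torus set set \<Rightarrow> 'n torus set"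
  where "flat_above = (\<lambda>(p, T). to_torus ` {x. walls x = T \<and> (\<exists>v. bottom x v \<and> to_torus v = p)})"

text \<open>All lifts of the vertex differ by integer translations, so the cells above them have the same image.\<close>

lemma flat_above_eq:
  assumes x: "bottom x v"
  shows "flat_above (to_torus v, walls x) = to_torus ` cell x"
proof (intro equalityI subsetI)
  fix q
  assume "q \<in> to_torus ` cell x"
  then obtain y where y: "y \<in> cell x" "q = to_torus y"
    by blast
  then have "walls y = walls x" "bottom y v"
    using x bottom_cong walls_eq_if_mem_cell by auto
  then show "q \<in> flat_above (to_torus v, walls x)"
    using y(2) by (auto simp: flat_above_def)
next
  fix q
  assume "q \<in> flat_above (to_torus v, walls x)"
  then obtain y w where y: "q = to_torus y" "walls y = walls x" "bottom y w" "to_torus w = to_torus v"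
    by (auto simp: flat_above_def)
  have int: "\<And>i. (v - w) $ i \<in> \<int>"
    using y(4) to_torus_eq_iff by metis
  then have per: "\<And>H. H \<in> A \<Longrightarrow> normal H \<bullet> (v - w) \<in> \<int>"
    by (intro normal_integral)
  have "bottom (y + (v - w)) v"
    using bottom_translate[OF per y(3)] by simp
  moreover have "walls x = walls (y + (v - w))"
    using walls_translate[OF per] y(2) by simp
  ultimately have "y + (v - w) \<in> cell x"
    by (rule cell_determined_by_bottom[OF x])
  moreover have "to_torus (y + (v - w)) = q"
    unfolding y(1) to_torus_eq_iff using int by simp
  ultimately show "q \<in> to_torus ` cell x"
    by blast
qed

lemma vertex_flagsE:
  assumes "(p, T) \<in> vertex_flags j"
  obtains v x where "p = to_torus v" "bottom x v" "walls x = T" "card T = j"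
proof -
  obtain v where v: "p = to_torus v"
    by (rule to_torus_cases)
  then have "card (walls v) = CARD('n)" "T \<subseteq> walls v" "card T = j"
    using assms by (auto simp: vertex_flags_def members_at_to_torus)
  then show thesis
    using cell_above_vertex[of v T] that v by auto
qed

text \<open>Every flat has one bottom: it is surjective because bottoms exist, and injective because a flat
determines its cell up to translation, and thereby the bottom of that cell up to the same
translation. That \<open>flat_above\<close> yields a flat is the existence of a cell above each vertex.\<close>

lemma bij_betw_flat_above:
  assumes "k \<le> CARD('n)"
  shows "bij_betw flat_above (vertex_flags (CARD('n) - k)) (flats A k)"
  unfolding bij_betw_def
proof (intro conjI inj_onI equalityI subsetI)
  fix f f'
  assume f: "f \<in> vertex_flags (CARD('n) - k)" and f': "f' \<in> vertex_flags (CARD('n) - k)"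
    and eq: "flat_above f = flat_above f'"
  obtain p T p' T' where pT: "f = (p, T)" "f' = (p', T')"
    by (metis surj_pair)
  obtain v x where x: "p = to_torus v" "bottom x v" "walls x = T"
    using f pT by (auto elim: vertex_flagsE)
  obtain v' x' where x': "p' = to_torus v'" "bottom x' v'" "walls x' = T'"
    using f' pT by (auto elim: vertex_flagsE)
  have "to_torus ` cell x = to_torus ` cell x'"
    using eq flat_above_eq[OF x(2)] flat_above_eq[OF x'(2)] by (simp add: pT x x')
  then obtain y where y: "y \<in> cell x'" "to_torus x = to_torus y"
    using self_in_cell[of x] by (metis image_eqI imageE)
  have int: "\<And>i. (x - y) $ i \<in> \<int>"
    using y(2) to_torus_eq_iff by metis
  then have per: "\<And>H. H \<in> A \<Longrightarrow> normal H \<bullet> (x - y) \<in> \<int>"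
    by (intro normal_integral)
  have "walls x = walls y"
    using walls_translate[OF per, of y] by simp
  then have "T = T'"
    using walls_eq_if_mem_cell[OF y(1)] x x' by simp
  have "bottom y v'"
    using bottom_cong[OF y(1)] x'(2) by simp
  then have "bottom x (v' + (x - y))"
    using bottom_translate[OF per, of y v'] by simp
  then have "v = v' + (x - y)"
    by (rule bottom_unique[OF x(2)])
  then have "p = p'"
    using int x(1) x'(1) by (simp add: to_torus_eq_iff)
  with \<open>T = T'\<close> show "f = f'"
    by (simp add: pT)
next
  fix F
  assume "F \<in> flat_above ` vertex_flags (CARD('n) - k)"
  then obtain p T where pT: "(p, T) \<in> vertex_flags (CARD('n) - k)" "F = flat_above (p, T)"
    by auto
  obtain v x where "p = to_torus v" "bottom x v" "walls x = T" "card T = CARD('n) - k"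
    using vertex_flagsE[OF pT(1)] by blast
  then show "F \<in> flats A k"
    using pT(2) flat_above_eq by (auto simp: flats_eq_cells[OF assms])
next
  fix F
  assume "F \<in> flats A k"
  then obtain x where x: "F = to_torus ` cell x" "card (walls x) = CARD('n) - k"
    by (auto simp: flats_eq_cells[OF assms])
  obtain v where v: "bottom x v"
    using bottom_exists by blast
  then have "walls x \<subseteq> walls v"
    by (intro walls_mono) (simp add: bottom_def)
  then have "(to_torus v, walls x) \<in> vertex_flags (CARD('n) - k)"
    using bottom_is_vertex[OF v] x(2) by (simp add: vertex_flags_def members_at_to_torus)
  then show "F \<in> flat_above ` vertex_flags (CARD('n) - k)"
    using flat_above_eq[OF v] x(1) by (metis image_eqI)
qed

lemma bij_betw_complement_flags:
  assumes "j \<le> CARD('n)"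
  shows "bij_betw (\<lambda>(p, T). (p, members_at A p - T)) (vertex_flags j) (vertex_flags (CARD('n) - j))"
proof -
  have fin: "finite (members_at A p)" for p
    using finite_A by (simp add: members_at_def)
  have card: "card (members_at A p - T) = card (members_at A p) - card T"
    if "T \<subseteq> members_at A p" for p T
    using that fin finite_subset by (metis card_Diff_subset)
  show ?thesis
    by (rule bij_betw_byWitness[where f' = "\<lambda>(p, T). (p, members_at A p - T)"])
       (use assms card in \<open>auto simp: vertex_flags_def\<close>)
qed

section \<open>The symmetry\<close>

lemma flats_bij:
  assumes k: "k \<le> CARD('n)"
  shows "\<exists>g. bij_betw g (flats A k) (flats A (CARD('n) - k))"
proof -
  have "bij_betw (inv_into (vertex_flags (CARD('n) - k)) flat_above)
      (flats A k) (vertex_flags (CARD('n) - k))"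
    by (rule bij_betw_inv_into[OF bij_betw_flat_above[OF k]])
  from bij_betw_trans[OF this bij_betw_complement_flags]
  show ?thesis
    using bij_betw_trans[OF _ bij_betw_flat_above[of "CARD('n) - k"]] by fastforce
qed

end

lemma toric_hyperplane_lift:
  fixes H :: "'n::finite torus set"
  assumes "is_hyperplane H"
  shows "\<exists>a b. \<forall>x. to_torus x \<in> H \<longleftrightarrow> (\<chi> i. real_of_int (a $ i)) \<bullet> x - b \<in> \<int>"
proof -
  obtain a b where H: "H = toric_hyperplane a b"
    using assms by (auto simp: is_hyperplane_def)
  obtain r where r: "b = to_circle r"
    by (induction b rule: circle.abs_induct) blast
  have "to_torus x \<in> H \<longleftrightarrow> (\<chi> i. real_of_int (a $ i)) \<bullet> x - r \<in> \<int>" for x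
    unfolding H to_torus_in_toric_hyperplane_iff r circle.abs_eq_iff congruent_Z_def
    by (simp add: inner_vec_def)
  then show ?thesis
    by blast
qed

theorem theorem4p7:
  fixes A :: "'n::finite torus set set"
  assumes "toric_arrangement A"
    and "\<forall>H\<in>A. simple_hyperplane H"
    and "general_position A"
    and "card A \<ge> CARD('n)"
    and "spanning A"
  shows "\<forall>k\<in>{0..CARD('n)}.
    (\<exists>g. bij_betw g (flats A k) (flats A (CARD('n) - k))) \<and>
    f_number A k = f_number A (CARD('n) - k)"
proof -
  have finite_A: "finite A"
    using assms(1) by (simp add: toric_arrangement_def)
  have "\<forall>H\<in>A. \<exists>a b. \<forall>x. to_torus x \<in> H \<longleftrightarrow> (\<chi> i. real_of_int (a $ i)) \<bullet> x - b \<in> \<int>"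
    using assms(1) toric_hyperplane_lift by (auto simp: toric_arrangement_def)
  then obtain a :: "'n torus set \<Rightarrow> int ^ 'n" and offset where lift:
    "\<And>H x. H \<in> A \<Longrightarrow> to_torus x \<in> H \<longleftrightarrow> (\<chi> i. real_of_int (a H $ i)) \<bullet> x - offset H \<in> \<int>"
    by metis
  define normal :: "'n torus set \<Rightarrow> real ^ 'n" where "normal H = (\<chi> i. real_of_int (a H $ i))" for H
  define level where "level H x = normal H \<bullet> x - offset H" for H x
  define walls where "walls x = {H\<in>A. level H x \<in> \<int>}" for x
  have mem: "to_torus x \<in> H \<longleftrightarrow> level H x \<in> \<int>" if "H \<in> A" for H x
    using lift[OF that] by (simp add: level_def normal_def)
  have walls_Inter: "to_torus x \<in> \<Inter>(walls x)" for x
    using mem by (auto simp: walls_def)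
  have walls_A: "walls x \<subseteq> A" for x
    by (auto simp: walls_def)
  have card_le: "card (walls x) \<le> CARD('n)" for x
    using assms(3) walls_A[of x] walls_Inter[of x] unfolding general_position_def
    by (metis empty_iff linorder_not_less)
  obtain height where height: "\<forall>S\<subseteq>A. card S < DIM(real ^ 'n) \<longrightarrow> height \<notin> span (normal ` S)"
    using generic_functional_exists[OF finite_A] by blast
  have vertex_normals: "d = 0" if v: "card (walls v) = CARD('n)"
    and d: "\<And>H. H \<in> walls v \<Longrightarrow> normal H \<bullet> d = 0" for v d
  proof (rule ccontr)
    assume "d \<noteq> 0"
    \<comment> \<open>Otherwise the line through \<open>v\<close> in direction \<open>d\<close> projects into the intersection of the \<open>n\<close>
      hyperplanes at \<open>v\<close>, which has dimension \<open>0\<close> by general position.\<close>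
    let ?L = "affine hull {v, v + d}"
    have "to_torus ` ?L \<subseteq> \<Inter>(walls v)"
    proof clarify
      fix y H
      assume "y \<in> ?L" and H: "H \<in> walls v"
      then obtain s t where "y = s *\<^sub>R v + t *\<^sub>R (v + d)" "s + t = 1"
        by (auto simp: affine_hull_2)
      then have "y = v + t *\<^sub>R d"
        by (simp add: algebra_simps flip: scaleR_add_left)
      then have "level H y = level H v"
        using d[OF H] by (simp add: level_def inner_right_distrib)
      then show "to_torus y \<in> H"
        using H mem by (auto simp: walls_def)
    qed
    then have "aff_dim ?L \<in> {aff_dim L | L. affine L \<and> to_torus ` L \<subseteq> \<Inter>(walls v)}"
      using affine_affine_hull by blast
    then have "aff_dim ?L \<le> toric_dim (\<Inter>(walls v))"
      unfolding toric_dim_def by (rule Max_ge[OF finite_toric_dim_candidates])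
    moreover have "toric_dim (\<Inter>(walls v)) \<le> 0"
      using assms(3)[unfolded general_position_def, rule_format, OF walls_A[of v]] v by simp
    moreover have "aff_dim ?L = 1"
      using \<open>d \<noteq> 0\<close> by (simp add: aff_dim_2)
    ultimately show False
      by simp
  qed
  have vertex_exists: "\<exists>v. card (walls v) = CARD('n)"
  proof -
    obtain S p where S: "S \<subseteq> A" "card S = CARD('n)" "p \<in> \<Inter>S"
      using assms(5) by (auto simp: spanning_def)
    obtain v where "p = to_torus v"
      by (rule to_torus_cases)
    then have "S \<subseteq> walls v"
      using S mem by (auto simp: walls_def)
    then have "card S \<le> card (walls v)"
      using finite_A walls_A by (meson card_mono finite_subset)
    then show ?thesis
      using S(2) card_le[of v] by (intro exI[of _ v]) simp
  qed
  interpret toric_lift A normal offset height level walls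
  proof unfold_locales
    show "normal H \<bullet> z \<in> \<int>" if "\<And>i. z $ i \<in> \<int>" for H z
      unfolding normal_def inner_vec_def using that by (intro Ints_sum) (auto intro: Ints_mult)
  qed (use finite_A card_le vertex_normals vertex_exists height mem in \<open>auto simp: level_def walls_def\<close>)
  show ?thesis
  proof
    fix k
    assume "k \<in> {0..CARD('n)}"
    then obtain g where g: "bij_betw g (flats A k) (flats A (CARD('n) - k))"
      using flats_bij by auto
    then show "(\<exists>g. bij_betw g (flats A k) (flats A (CARD('n) - k))) \<and>
        f_number A k = f_number A (CARD('n) - k)"
      unfolding f_number_def using bij_betw_same_card by blast
  qed
qed

end
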